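(* Let $n\ge 1$. The rational loop group $\mathcal{L}^-\mathrm{GL}_n\mathbb{R}$ is generated (as a group) by the following three families of elements: (1) $p_{\alpha,\beta,V,W}(\lambda)=\left(\frac{\lambda-\alpha}{\lambda-\beta}\right)\pi_V+\pi_W$, where $\alpha,\beta\in\mathbb{R}$, $\mathbb{C}^n=V\oplus W$, $\bar V=V$, $\bar W=W$; (2) $q_{\alpha,\beta,V,W}(\lambda)=\frac{(\lambda-\alpha)(\lambda-\bar\alpha)}{(\lambda-\beta)(\lambda-\bar\beta)}\pi_V+\pi_W$, where $\alpha,\beta\in\mathbb{C}$ with $\alpha\notin\mathbb{R}$ or $\beta\notin\mathbb{R}$, $\mathbb{C}^n=V\oplus W$, $\bar V=V$, $\bar W=W$; (3) $r_{\alpha,\beta,V,W}(\lambda)=\left(\frac{\lambda-\alpha}{\lambda-\beta}\right)\pi_V+\pi_W+\left(\frac{\lambda-\bar\alpha}{\lambda-\bar\beta}\right)\pi_{\bar V}$, where $\alpha,\beta\in\mathbb{C}$, $\mathbb{C}^n=V\oplus W\oplus\bar V$, $V\cap\bar V=0$, $\bar W=W$.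
   Context: $\mathcal{L}^-\mathrm{GL}_n\mathbb{C}$ denotes the group (under pointwise multiplication) of all non-degenerate (determinant not identically zero) $n\times n$ matrices $g(\lambda)$ of complex rational functions of $\lambda$ normalized by $g(\infty)=\mathrm{I}$. $\mathcal{L}^-\mathrm{GL}_n\mathbb{R}$ is its subgroup of loops satisfying the $\mathrm{GL}_n\mathbb{R}$-reality condition $\overline{g(\bar\lambda)}=g(\lambda)$. Bars on vectors, subspaces and matrices denote entrywise complex conjugation in $\mathbb{C}^n$. All $V,W$ are complex subspaces of $\mathbb{C}^n$, and $\pi_V,\pi_W,\pi_{\bar V}$ are the projections onto the respective summands of the given direct sum decomposition along the other summand(s). *)

theory Defs
  imports
    "HOL-Analysis.Analysis"
    "HOL-Library.Set_Algebras"
    "HOL-Computational_Algebra.Normalized_Fraction"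
    "HOL-Computational_Algebra.Polynomial_Factorial"
    "HOL-Computational_Algebra.Field_as_Ring"
    "HOL-Algebra.Generated_Groups"
begin

section \<open>Rational functions and rational matrices\<close>

type_synonym ratfun = "complex poly fract"

definition ratfun_const :: "complex \<Rightarrow> ratfun" where
  "ratfun_const c = to_fract [:c:]"

text \<open>
  Poles and values are read off from the representation in lowest terms given by
  \<open>quot_of_fract\<close>.  The value at a pole is a meaningless 0.
\<close>

definition ratfun_pole :: "ratfun \<Rightarrow> complex \<Rightarrow> bool" where
  "ratfun_pole f z \<longleftrightarrow> poly (snd (quot_of_fract f)) z = 0"

definition ratfun_eval :: "ratfun \<Rightarrow> complex \<Rightarrow> complex" where
  "ratfun_eval f z = poly (fst (quot_of_fract f)) z / poly (snd (quot_of_fract f)) z"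

definition ratmat_pole :: "ratfun ^ 'n ^ 'n::finite \<Rightarrow> complex \<Rightarrow> bool" where
  "ratmat_pole g z \<longleftrightarrow> (\<exists>i j. ratfun_pole (g $ i $ j) z)"

definition ratmat_eval :: "ratfun ^ 'n ^ 'n::finite \<Rightarrow> complex \<Rightarrow> complex ^ 'n ^ 'n" where
  "ratmat_eval g z = map_matrix (\<lambda>f. ratfun_eval f z) g"

section \<open>The rational loop groups\<close>

definition LGL_complex :: "(ratfun ^ 'n ^ 'n::finite) monoid" where
  "LGL_complex =
     \<lparr>carrier = {g. det g \<noteq> 0 \<and> (ratmat_eval g \<longlongrightarrow> mat 1) at_infinity},
      mult = (**),
      one = mat 1\<rparr>"

text \<open>The reality condition is an identity of rational functions, hence is imposed off the poles.\<close>

definition GL_real_condition :: "ratfun ^ 'n ^ 'n::finite \<Rightarrow> bool" where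
  "GL_real_condition g \<longleftrightarrow>
     (\<forall>z. \<not> ratmat_pole g z \<longrightarrow> \<not> ratmat_pole g (cnj z) \<longrightarrow>
          map_matrix cnj (ratmat_eval g (cnj z)) = ratmat_eval g z)"

definition LGL_real :: "(ratfun ^ 'n ^ 'n::finite) monoid" where
  "LGL_real = LGL_complex\<lparr>carrier := {g \<in> carrier LGL_complex. GL_real_condition g}\<rparr>"

section \<open>Subspaces, direct sums and projections\<close>

text \<open>
  Complex subspaces are those of \<open>vec.subspace\<close>; the unqualified \<open>subspace\<close> would only
  mean real subspaces.
\<close>

definition conj_space :: "(complex ^ 'n::finite) set \<Rightarrow> (complex ^ 'n) set" where
  "conj_space V = (\<lambda>v. \<chi> i. cnj (v $ i)) ` V"

definition direct_sum2 :: "(complex ^ 'n::finite) set \<Rightarrow> (complex ^ 'n) set \<Rightarrow> bool" where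
  "direct_sum2 V W \<longleftrightarrow>
     vec.subspace V \<and> vec.subspace W \<and> V \<inter> W = {0} \<and> V + W = UNIV"

definition direct_sum3 ::
    "(complex ^ 'n::finite) set \<Rightarrow> (complex ^ 'n) set \<Rightarrow> (complex ^ 'n) set \<Rightarrow> bool" where
  "direct_sum3 U V W \<longleftrightarrow>
     vec.subspace U \<and> vec.subspace V \<and> vec.subspace W \<and>
     U \<inter> (V + W) = {0} \<and> V \<inter> (U + W) = {0} \<and> W \<inter> (U + V) = {0} \<and> U + V + W = UNIV"

text \<open>The projection onto \<open>V\<close> along \<open>W\<close>, for \<open>V\<close> and \<open>W\<close> with \<open>direct_sum2 V W\<close>.\<close>

definition proj :: "(complex ^ 'n::finite) set \<Rightarrow> (complex ^ 'n) set \<Rightarrow> complex ^ 'n ^ 'n" where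
  "proj V W = (THE P. (\<forall>v\<in>V. P *v v = v) \<and> (\<forall>w\<in>W. P *v w = 0))"

section \<open>The generators\<close>

definition scaled :: "ratfun \<Rightarrow> complex ^ 'n ^ 'n \<Rightarrow> ratfun ^ 'n ^ 'n::finite" where
  "scaled f A = map_matrix (\<lambda>a. f * ratfun_const a) A"

definition linear_frac :: "complex \<Rightarrow> complex \<Rightarrow> ratfun" where
  "linear_frac \<alpha> \<beta> = Fract [:-\<alpha>, 1:] [:-\<beta>, 1:]"

definition p_loop ::
    "complex \<Rightarrow> complex \<Rightarrow> (complex ^ 'n::finite) set \<Rightarrow> (complex ^ 'n) set \<Rightarrow> ratfun ^ 'n ^ 'n" where
  "p_loop \<alpha> \<beta> V W = scaled (linear_frac \<alpha> \<beta>) (proj V W) + scaled 1 (proj W V)"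

definition q_loop ::
    "complex \<Rightarrow> complex \<Rightarrow> (complex ^ 'n::finite) set \<Rightarrow> (complex ^ 'n) set \<Rightarrow> ratfun ^ 'n ^ 'n" where
  "q_loop \<alpha> \<beta> V W =
     scaled (Fract ([:-\<alpha>, 1:] * [:- cnj \<alpha>, 1:]) ([:-\<beta>, 1:] * [:- cnj \<beta>, 1:])) (proj V W)
     + scaled 1 (proj W V)"

definition r_loop ::
    "complex \<Rightarrow> complex \<Rightarrow> (complex ^ 'n::finite) set \<Rightarrow> (complex ^ 'n) set \<Rightarrow> ratfun ^ 'n ^ 'n" where
  "r_loop \<alpha> \<beta> V W =
     scaled (linear_frac \<alpha> \<beta>) (proj V (W + conj_space V))
     + scaled 1 (proj W (V + conj_space V))
     + scaled (linear_frac (cnj \<alpha>) (cnj \<beta>)) (proj (conj_space V) (V + W))"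

definition p_loops :: "(ratfun ^ 'n ^ 'n::finite) set" where
  "p_loops = {p_loop \<alpha> \<beta> V W | \<alpha> \<beta> V W.
     \<alpha> \<in> \<real> \<and> \<beta> \<in> \<real> \<and> direct_sum2 V W \<and> conj_space V = V \<and> conj_space W = W}"

definition q_loops :: "(ratfun ^ 'n ^ 'n::finite) set" where
  "q_loops = {q_loop \<alpha> \<beta> V W | \<alpha> \<beta> V W.
     (\<alpha> \<notin> \<real> \<or> \<beta> \<notin> \<real>) \<and> direct_sum2 V W \<and> conj_space V = V \<and> conj_space W = W}"

definition r_loops :: "(ratfun ^ 'n ^ 'n::finite) set" where
  "r_loops = {r_loop \<alpha> \<beta> V W | \<alpha> \<beta> V W.
     direct_sum3 V W (conj_space V) \<and> V \<inter> conj_space V = {0} \<and> conj_space W = W}"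

end

theory Submission
  imports Defs "HOL-Computational_Algebra.Fundamental_Theorem_Algebra"
begin

text \<open>
  Let \<open>M\<close> be the ideal of real rational functions vanishing at infinity.  The real loop group is
  the congruence group of matrices \<open>1 + A\<close> with entries of \<open>A\<close> in \<open>M\<close>.  Since \<open>1 + M\<close> consists of
  units, Gaussian elimination writes each element as a product of elementary matrices with an entry
  from \<open>M\<close> and diagonal matrices with an entry from \<open>1 + M\<close>.  The diagonal ones are products of
  loops of the first two families, by factoring real polynomials into linear and quadratic factors.
  A loop of the first family whose projection is \<open>E\<^sub>i\<^sub>i + c E\<^sub>i\<^sub>j\<close> yields the elementary matrix with
  entry \<open>c/\<lambda>\<close>, and conjugation by diagonal matrices extends this to all entries in \<open>M\<close>.  Hence the
  first two families already generate.
\<close>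

section \<open>Real rational functions vanishing at infinity\<close>

definition real_poly :: "complex poly \<Rightarrow> bool" where
  "real_poly p \<longleftrightarrow> map_poly cnj p = p"

lemma real_poly_cnj: "real_poly p \<Longrightarrow> cnj (poly p (cnj z)) = poly p z"
  by (metis poly_map_poly_cnj real_poly_def)

lemma map_poly_cnj_mult: "map_poly cnj (p * q) = map_poly cnj p * map_poly cnj q"
  by (simp add: poly_eq_poly_eq_iff[symmetric] fun_eq_iff)

lemma map_poly_cnj_add: "map_poly cnj (p + q) = map_poly cnj p + map_poly cnj q"
  by (simp add: poly_eq_poly_eq_iff[symmetric] fun_eq_iff)

lemma map_poly_cnj_uminus: "map_poly cnj (- p) = - map_poly cnj p"
  by (simp add: poly_eq_poly_eq_iff[symmetric] fun_eq_iff)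

lemma map_poly_cnj_eq_0_iff [simp]: "map_poly cnj p = 0 \<longleftrightarrow> p = 0"
proof -
  have "map_poly cnj (map_poly cnj p) = p" by (simp add: poly_eq_poly_eq_iff[symmetric] fun_eq_iff)
  thus ?thesis by (metis map_poly_0)
qed

lemma degree_map_poly_cnj [simp]: "degree (map_poly cnj p) = degree p"
  by (cases "p = 0") (auto intro!: map_poly_degree_eq)

lemma lead_coeff_map_poly_cnj [simp]: "lead_coeff (map_poly cnj p) = cnj (lead_coeff p)"
  by (simp add: coeff_map_poly)

lemma real_poly_intros [simp, intro]:
  "real_poly 0" "real_poly 1"
  "real_poly p \<Longrightarrow> real_poly q \<Longrightarrow> real_poly (p + q)"
  "real_poly p \<Longrightarrow> real_poly q \<Longrightarrow> real_poly (p * q)"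
  "real_poly p \<Longrightarrow> real_poly (- p)"
  "real_poly p \<Longrightarrow> real_poly q \<Longrightarrow> real_poly (p - q)"
  "real_poly p \<Longrightarrow> real_poly (p ^ n)"
proof -
  show *: "real_poly 0" "real_poly 1"
    "real_poly p \<Longrightarrow> real_poly q \<Longrightarrow> real_poly (p + q)"
    "real_poly p \<Longrightarrow> real_poly q \<Longrightarrow> real_poly (p * q)"
    "real_poly p \<Longrightarrow> real_poly (- p)" for p q
    by (auto simp: real_poly_def map_poly_cnj_mult map_poly_cnj_add map_poly_cnj_uminus)
  show "real_poly p \<Longrightarrow> real_poly q \<Longrightarrow> real_poly (p - q)"
    using *(3)[of p "- q"] *(5)[of q] by simp
  show "real_poly p \<Longrightarrow> real_poly (p ^ n)"
    by (induction n) (auto intro: *)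
qed

lemma real_poly_pCons_iff: "real_poly (pCons a p) \<longleftrightarrow> a \<in> \<real> \<and> real_poly p"
  by (simp add: real_poly_def map_poly_pCons Reals_cnj_iff)

text \<open>Conjugation is multiplicative, so \<open>s\<close> cancels from the conjugated identity.
  This keeps the cofactor real when a real factor is split off.\<close>

lemma real_poly_mult_cancel:
  assumes "real_poly (s * p)" "real_poly s" "s \<noteq> 0"
  shows "real_poly p"
proof -
  have "s * map_poly cnj p = s * p"
    using assms by (simp add: real_poly_def map_poly_cnj_mult)
  thus ?thesis using assms(3) by (simp add: real_poly_def)
qed

section \<open>Values and poles of rational functions\<close>

lemma poly_eq_if_infinite:
  fixes p q :: "'a::idom poly"
  assumes "infinite {z. poly p z = poly q z}"
  shows "p = q"
proof (rule ccontr)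
  assume "p \<noteq> q"
  hence "finite {z. poly (p - q) z = 0}" by (intro poly_roots_finite) auto
  thus False using assms by simp
qed

lemma poly_eventually_nonzero_at_infinity:
  fixes p :: "'a::real_normed_field poly"
  assumes "p \<noteq> 0"
  shows "eventually (\<lambda>z. poly p z \<noteq> 0) at_infinity"
proof -
  have "eventually (\<lambda>z. \<forall>r\<in>{r. poly p r = 0}. z \<noteq> r) at_infinity"
    using poly_roots_finite[OF assms] eventually_not_equal_at_infinity
    by (intro eventually_ball_finite) auto
  thus ?thesis by eventually_elim auto
qed

text \<open>By coprimality the reduced denominator divides \<open>q\<close>, so it cannot vanish
  where \<open>q\<close> does not, and any representation may be used for evaluation there.\<close>

lemma ratfun_eval_Fract:
  fixes f :: ratfun
  assumes "f = Fract p q" "poly q z \<noteq> 0"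
  shows "ratfun_eval f z = poly p z / poly q z"
proof -
  define a b where "a = fst (quot_of_fract f)" and "b = snd (quot_of_fract f)"
  have "Fract a b = Fract p q" using assms(1) by (simp add: a_def b_def)
  moreover have b0: "b \<noteq> 0" and q0: "q \<noteq> 0" using assms by (auto simp: b_def)
  ultimately have eq: "a * q = p * b" by (simp add: eq_fract)
  have "coprime a b" by (simp add: a_def b_def coprime_quot_of_fract)
  moreover have "b dvd a * q" by (simp add: eq)
  ultimately have "b dvd q" by (simp add: coprime_commute coprime_dvd_mult_right_iff)
  hence bz: "poly b z \<noteq> 0" using assms(2) by (auto elim!: dvdE)
  have "poly a z * poly q z = poly p z * poly b z" using eq by (metis poly_mult)
  thus "ratfun_eval f z = poly p z / poly q z"
    using bz assms(2) by (simp add: ratfun_eval_def a_def b_def field_simps)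
qed

lemma finite_ratfun_poles: "finite {z. ratfun_pole f z}"
  unfolding ratfun_pole_def by (rule poly_roots_finite) simp

lemma finite_ratmat_poles: "finite {z. ratmat_pole g z}"
proof -
  have "{z. ratmat_pole g z} = (\<Union>i. \<Union>j. {z. ratfun_pole (g $ i $ j) z})"
    by (auto simp: ratmat_pole_def)
  thus ?thesis by (simp add: finite_ratfun_poles)
qed

text \<open>Lowest terms with a monic denominator are unique, so an identity with the conjugate fraction
  is an identity of numerators and of denominators.\<close>

lemma real_poly_quot_of_fract:
  fixes f :: ratfun
  defines "a \<equiv> fst (quot_of_fract f)" and "b \<equiv> snd (quot_of_fract f)"
  assumes eq: "map_poly cnj a * b = a * map_poly cnj b"
  shows "real_poly a" "real_poly b"
proof -
  have b0: "b \<noteq> 0" by (simp add: b_def)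
  have "b dvd a * map_poly cnj b" by (simp flip: eq)
  moreover have "coprime a b" by (simp add: a_def b_def coprime_quot_of_fract)
  ultimately have "b dvd map_poly cnj b" by (simp add: coprime_commute coprime_dvd_mult_right_iff)
  then obtain c where c: "map_poly cnj b = b * c" by (elim dvdE)
  have "c \<noteq> 0" using c b0 by (metis map_poly_cnj_eq_0_iff mult_zero_right)
  \<comment> \<open>Conjugation preserves the degree, so the quotient \<open>c\<close> is constant;
    comparing leading coefficients of the monic \<open>b\<close> then makes it 1.\<close>
  hence "degree b = degree b + degree c"
    using c b0 degree_mult_eq[of b c] by (metis degree_map_poly_cnj)
  then obtain k where k: "c = [:k:]" by (auto elim: degree_eq_zeroE)
  have "unit_factor b = 1" by (simp add: b_def unit_factor_snd_quot_of_fract)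
  hence "lead_coeff b = 1" using b0 by (simp add: unit_factor_poly_def one_pCons)
  hence "k = 1" using c k
    by (metis complex_cnj_one lead_coeff_map_poly_cnj lead_coeff_mult lead_coeff_pCons(2) mult_1)
  thus "real_poly b" using c k by (simp add: real_poly_def)
  thus "real_poly a" using eq b0 by (simp add: real_poly_def)
qed

lemma real_poly_quot_of_fract_if_real_values:
  assumes "infinite {z. \<not> ratfun_pole f z \<and> \<not> ratfun_pole f (cnj z) \<and>
      cnj (ratfun_eval f (cnj z)) = ratfun_eval f z}"
  shows "real_poly (fst (quot_of_fract f))" "real_poly (snd (quot_of_fract f))"
proof -
  define a b where "a = fst (quot_of_fract f)" and "b = snd (quot_of_fract f)"
  have "map_poly cnj a * b = a * map_poly cnj b"
    by (rule poly_eq_if_infinite, rule infinite_super[OF _ assms])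
      (auto simp: ratfun_pole_def ratfun_eval_def a_def b_def frac_eq_eq)
  thus "real_poly (fst (quot_of_fract f))" "real_poly (snd (quot_of_fract f))"
    unfolding a_def b_def by (rule real_poly_quot_of_fract)+
qed

text \<open>Poles are included: the reduced numerator and denominator are themselves real, hence
  \<open>z\<close> and \<open>cnj z\<close> are poles together and both values there are 0.\<close>

lemma cnj_ratfun_eval:
  assumes "f = Fract p q" "q \<noteq> 0" "real_poly p" "real_poly q"
  shows "cnj (ratfun_eval f (cnj z)) = ratfun_eval f z"
proof -
  define a b where "a = fst (quot_of_fract f)" and "b = snd (quot_of_fract f)"
  have "Fract a b = Fract p q" using assms(1) by (simp add: a_def b_def)
  moreover have b0: "b \<noteq> 0" by (simp add: b_def)
  ultimately have eq: "a * q = p * b" using assms by (simp add: eq_fract)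
  hence eq': "map_poly cnj a * q = p * map_poly cnj b"
    using assms by (metis real_poly_def map_poly_cnj_mult)
  have "(map_poly cnj a * b) * q = (a * map_poly cnj b) * q"
    using eq eq' by (metis mult.assoc mult.commute)
  hence *: "map_poly cnj a * b = a * map_poly cnj b" using assms by simp
  have "real_poly a" "real_poly b"
    using real_poly_quot_of_fract[OF *[unfolded a_def b_def]] by (simp_all add: a_def b_def)
  thus ?thesis
    by (simp add: ratfun_eval_def a_def b_def real_poly_cnj)
qed

section \<open>The ideal of real proper fractions and the units congruent to 1\<close>

definition real_proper :: "ratfun set" where
  "real_proper = {Fract p q | p q. real_poly p \<and> real_poly q \<and> q \<noteq> 0 \<and> (p = 0 \<or> degree p < degree q)}"

lemma real_properI:
  "real_poly p \<Longrightarrow> real_poly q \<Longrightarrow> q \<noteq> 0 \<Longrightarrow> p = 0 \<or> degree p < degree q \<Longrightarrow> Fract p q \<in> real_proper"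
  by (auto simp: real_proper_def)

lemma real_properE:
  assumes "f \<in> real_proper"
  obtains p q where "f = Fract p q" "real_poly p" "real_poly q" "q \<noteq> 0" "p = 0 \<or> degree p < degree q"
  using assms by (auto simp: real_proper_def)

lemma zero_in_real_proper [simp, intro]: "0 \<in> real_proper"
  using real_properI[of 0 1] by (simp add: fract_collapse)

lemma real_proper_add [intro]:
  assumes "f \<in> real_proper" "g \<in> real_proper"
  shows "f + g \<in> real_proper"
proof -
  obtain p q where f: "f = Fract p q" "real_poly p" "real_poly q" "q \<noteq> 0" "p = 0 \<or> degree p < degree q"
    using assms(1) by (rule real_properE)
  obtain r s where g: "g = Fract r s" "real_poly r" "real_poly s" "s \<noteq> 0" "r = 0 \<or> degree r < degree s"
    using assms(2) by (rule real_properE)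
  have "p * s + r * q = 0 \<or> degree (p * s + r * q) < degree (q * s)"
  proof (cases "p = 0 \<or> r = 0")
    case True
    thus ?thesis
    proof
      assume "p = 0"
      thus ?thesis using f g by (cases "r = 0") (auto simp: degree_mult_eq)
    next
      assume "r = 0"
      thus ?thesis using f g by (cases "p = 0") (auto simp: degree_mult_eq)
    qed
  next
    case False
    hence "degree (p * s) < degree (q * s)" "degree (r * q) < degree (q * s)"
      using f g by (auto simp: degree_mult_eq)
    thus ?thesis by (simp add: degree_add_less)
  qed
  thus ?thesis using f g by (auto intro!: real_properI)
qed

lemma real_proper_mult [intro]:
  assumes "f \<in> real_proper" "g \<in> real_proper"
  shows "f * g \<in> real_proper"
proof -
  obtain p q where f: "f = Fract p q" "real_poly p" "real_poly q" "q \<noteq> 0" "p = 0 \<or> degree p < degree q"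
    using assms(1) by (rule real_properE)
  obtain r s where g: "g = Fract r s" "real_poly r" "real_poly s" "s \<noteq> 0" "r = 0 \<or> degree r < degree s"
    using assms(2) by (rule real_properE)
  have "p * r = 0 \<or> degree (p * r) < degree (q * s)"
    using f g by (cases "p = 0 \<or> r = 0") (auto simp: degree_mult_eq)
  thus ?thesis using f g by (auto intro!: real_properI)
qed

lemma real_proper_uminus [intro]: "f \<in> real_proper \<Longrightarrow> - f \<in> real_proper"
  by (elim real_properE) (auto intro!: real_properI)

lemma real_proper_diff [intro]: "f \<in> real_proper \<Longrightarrow> g \<in> real_proper \<Longrightarrow> f - g \<in> real_proper"
  using real_proper_add[of f "- g"] real_proper_uminus[of g] by simp

lemma real_proper_sum [intro]:
  "(\<And>x. x \<in> A \<Longrightarrow> f x \<in> real_proper) \<Longrightarrow> sum f A \<in> real_proper"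
  by (induction A rule: infinite_finite_induct) auto

text \<open>Adding 1 to a proper fraction \<open>p/q\<close> gives \<open>(p + q)/q\<close>, whose
  two parts share degree and leading coefficient. The resulting normal form is symmetric in
  numerator and denominator.\<close>

lemma one_plus_real_proper:
  assumes "u - 1 \<in> real_proper"
  obtains p q where "u = Fract p q" "real_poly p" "real_poly q"
    "lead_coeff p = 1" "lead_coeff q = 1" "degree p = degree q"
proof -
  obtain p q where f: "u - 1 = Fract p q" "real_poly p" "real_poly q" "q \<noteq> 0" "p = 0 \<or> degree p < degree q"
    using assms by (rule real_properE)
  \<comment> \<open>Rescaling by \<open>c\<close> makes both parts monic; it keeps them real because
    the leading coefficient of a real polynomial is real.\<close>
  define c where "c = inverse (lead_coeff q)"
  have c0: "c \<noteq> 0" using f by (simp add: c_def)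
  have "cnj (lead_coeff q) = lead_coeff q"
    using f(3) by (metis lead_coeff_map_poly_cnj real_poly_def)
  hence "c \<in> \<real>" by (simp add: c_def Reals_cnj_iff)
  hence rc: "real_poly [:c:]" by (simp add: real_poly_pCons_iff)
  have d: "degree (p + q) = degree q" "lead_coeff (p + q) = lead_coeff q"
    using f(4,5) by (auto simp: degree_add_eq_right coeff_eq_0)
  have "u = 1 + Fract p q" by (simp flip: f(1))
  also have "\<dots> = Fract (p + q) q" using f(4) by (simp add: One_fract_def add.commute)
  also have "\<dots> = Fract ([:c:] * (p + q)) ([:c:] * q)" using f(4) c0 by (simp add: eq_fract)
  finally show ?thesis
    using f c0 rc d by (intro that[of "[:c:] * (p + q)" "[:c:] * q"] real_poly_intros)
      (auto simp: c_def)
qed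

lemma one_plus_real_proper_nonzero:
  assumes "u - 1 \<in> real_proper"
  shows "u \<noteq> 0"
proof -
  obtain p q where "u = Fract p q" "lead_coeff p = 1" "lead_coeff q = 1"
    using one_plus_real_proper[OF assms] by metis
  moreover have "Fract p q \<noteq> Fract 0 1" if "lead_coeff p = 1" "lead_coeff q = 1" for p q :: "complex poly"
    using that eq_fract(1)[of q 1 p 0] by (cases "q = 0"; cases "p = 0") auto
  ultimately show ?thesis by (metis Zero_fract_def)
qed

text \<open>The leading terms cancel in \<open>p - q\<close>. This is the converse of
  \<open>one_plus_real_proper\<close>.\<close>

lemma Fract_monic_real:
  assumes "real_poly p" "real_poly q" "lead_coeff p = 1" "lead_coeff q = 1" "degree p = degree q"
  shows "Fract p q - 1 \<in> real_proper"
proof -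
  have "q \<noteq> 0" using assms by auto
  hence "Fract p q - 1 = Fract (p - q) q" by (simp add: One_fract_def)
  moreover have "p - q = 0 \<or> degree (p - q) < degree q"
  proof (rule disjCI)
    assume "\<not> degree (p - q) < degree q"
    moreover have "degree (p - q) \<le> degree q" using assms by (metis degree_diff_le_max max.idem)
    ultimately have "degree (p - q) = degree q" by simp
    hence "lead_coeff (p - q) = 0" using assms by simp
    thus "p - q = 0" by (simp only: leading_coeff_0_iff)
  qed
  ultimately show ?thesis using assms \<open>q \<noteq> 0\<close> by (auto intro!: real_properI)
qed

text \<open>Inversion swaps the two parts of the monic normal form, so
  \<open>1 + real_proper\<close> consists of units and is closed under inverses.\<close>

lemma one_plus_real_proper_inverse:
  assumes "u - 1 \<in> real_proper"
  shows "inverse u - 1 \<in> real_proper"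
proof -
  obtain p q where "u = Fract p q" "real_poly p" "real_poly q"
    "lead_coeff p = 1" "lead_coeff q = 1" "degree p = degree q"
    using one_plus_real_proper[OF assms] by metis
  thus ?thesis by (simp add: Fract_monic_real)
qed

section \<open>Properness in terms of the limit at infinity and the reality condition\<close>

lemma real_proper_shiftE:
  assumes "f - ratfun_const c \<in> real_proper" "c \<in> \<real>"
  obtains p q where "f = Fract (p + [:c:] * q) q" "real_poly p" "real_poly q" "real_poly (p + [:c:] * q)"
    "q \<noteq> 0" "p = 0 \<or> degree p < degree q"
proof -
  obtain p q where f: "f - ratfun_const c = Fract p q" "real_poly p" "real_poly q" "q \<noteq> 0"
    "p = 0 \<or> degree p < degree q" using assms(1) by (rule real_properE)
  have "f = Fract p q + ratfun_const c" by (simp flip: f(1))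
  also have "\<dots> = Fract (p + [:c:] * q) q" using f(4)
    by (simp add: ratfun_const_def to_fract_def)
  finally have "f = Fract (p + [:c:] * q) q" .
  moreover have "real_poly (p + [:c:] * q)"
    using f assms by (intro real_poly_intros) (auto simp: real_poly_pCons_iff)
  ultimately show ?thesis using that f by blast
qed

lemma real_proper_imp_cnj_eval:
  assumes "f - ratfun_const c \<in> real_proper" "c \<in> \<real>"
  shows "cnj (ratfun_eval f (cnj z)) = ratfun_eval f z"
proof -
  obtain p q where "f = Fract (p + [:c:] * q) q" "q \<noteq> 0" "real_poly (p + [:c:] * q)" "real_poly q"
    using assms by (rule real_proper_shiftE)
  thus ?thesis by (rule cnj_ratfun_eval)
qed

lemma real_proper_imp_tendsto:
  assumes "f - ratfun_const c \<in> real_proper" "c \<in> \<real>"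
  shows "(ratfun_eval f \<longlongrightarrow> c) at_infinity"
proof -
  obtain p q where f: "f = Fract (p + [:c:] * q) q" "q \<noteq> 0" "p = 0 \<or> degree p < degree q"
    using assms by (rule real_proper_shiftE)
  have "((\<lambda>z. poly p z / poly q z) \<longlongrightarrow> 0) at_infinity"
    using f(3) poly_divide_tendsto_0_at_infinity[of p q] by auto
  hence "((\<lambda>z. poly p z / poly q z + c) \<longlongrightarrow> 0 + c) at_infinity" by (intro tendsto_intros)
  moreover have "eventually (\<lambda>z. ratfun_eval f z = poly p z / poly q z + c) at_infinity"
    using poly_eventually_nonzero_at_infinity[OF f(2)]
    by eventually_elim (simp add: ratfun_eval_Fract[OF f(1)] add_divide_distrib)
  ultimately show ?thesis by (simp add: tendsto_cong)
qed

text \<open>Reality off a finite set is an identity at infinitely many points, so the lowest terms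
  are real; the limit then forces the numerator of \<open>f - c\<close> to have smaller degree than
  the denominator.\<close>

lemma in_real_properI:
  assumes "c \<in> \<real>" and A: "(ratfun_eval f \<longlongrightarrow> c) at_infinity" and S: "finite S"
    "\<And>z. z \<notin> S \<Longrightarrow> cnj z \<notin> S \<Longrightarrow> cnj (ratfun_eval f (cnj z)) = ratfun_eval f z"
  shows "f - ratfun_const c \<in> real_proper"
proof -
  define a b where "a = fst (quot_of_fract f)" and "b = snd (quot_of_fract f)"
  have f: "f = Fract a b" and b0: "b \<noteq> 0" by (simp_all add: a_def b_def)
  define T where "T = S \<union> {z. ratfun_pole f z}"
  have "finite (T \<union> cnj ` T)" using S(1) finite_ratfun_poles by (auto simp: T_def)
  hence "infinite (- (T \<union> cnj ` T))" 
    by (simp add: infinite_UNIV_char_0 Compl_eq_Diff_UNIV Diff_infinite_finite)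
  moreover have "cnj z \<notin> T" if "z \<notin> cnj ` T" for z using that by (metis complex_cnj_cnj imageI)
  ultimately have inf: "infinite {z. \<not> ratfun_pole f z \<and> \<not> ratfun_pole f (cnj z) \<and>
      cnj (ratfun_eval f (cnj z)) = ratfun_eval f z}"
    by (elim infinite_super[rotated]) (use S(2) in \<open>auto simp: T_def\<close>)
  have r: "real_poly a" "real_poly b"
    using real_poly_quot_of_fract_if_real_values[OF inf] by (simp_all add: a_def b_def)
  define p where "p = a - [:c:] * b"
  have ev: "eventually (\<lambda>z. ratfun_eval f z - c = poly p z / poly b z) at_infinity"
    using poly_eventually_nonzero_at_infinity[OF b0]
    by eventually_elim (simp add: ratfun_eval_Fract[OF f] p_def diff_divide_distrib)
  have "((\<lambda>z. ratfun_eval f z - c) \<longlongrightarrow> c - c) at_infinity" by (intro tendsto_intros A)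
  hence lim: "((\<lambda>z. poly p z / poly b z) \<longlongrightarrow> 0) at_infinity"
    using ev by (simp add: tendsto_cong)
  have "p = 0 \<or> degree p < degree b"
  proof (rule ccontr)
    assume "\<not> ?thesis"
    hence p0: "p \<noteq> 0" and d: "degree b \<le> degree p" by auto
    \<comment> \<open>Otherwise \<open>b/p\<close> has a finite limit \<open>L\<close>, and the
      product of \<open>p/b\<close> and \<open>b/p\<close>, which is eventually 1, would tend to
      \<open>0 * L\<close>.\<close>
    obtain L where "((\<lambda>z. poly b z / poly p z) \<longlongrightarrow> L) at_infinity"
    proof (cases "degree b = degree p")
      case True
      have "((\<lambda>z. (poly b z / z ^ degree p) / (poly p z / z ^ degree p)) \<longlongrightarrow>
          lead_coeff b / lead_coeff p) at_infinity"
        using p0 poly_divide_tendsto_aux[of b] poly_divide_tendsto_aux[of p] True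
        by (intro tendsto_divide) auto
      moreover have "eventually (\<lambda>z. (poly b z / z ^ degree p) / (poly p z / z ^ degree p) =
          poly b z / poly p z) at_infinity"
        using eventually_not_equal_at_infinity[of 0] by eventually_elim simp
      ultimately show ?thesis by (intro that) (rule Lim_transform_eventually)
    next
      case False
      hence "degree b < degree p" using d by simp
      thus ?thesis by (rule that[OF poly_divide_tendsto_0_at_infinity])
    qed
    hence "((\<lambda>z. (poly p z / poly b z) * (poly b z / poly p z)) \<longlongrightarrow> 0 * L) at_infinity"
      by (intro tendsto_mult lim)
    moreover have "eventually (\<lambda>z. (poly p z / poly b z) * (poly b z / poly p z) = 1) at_infinity"
      using poly_eventually_nonzero_at_infinity[OF b0] poly_eventually_nonzero_at_infinity[OF p0]
      by eventually_elim simp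
    ultimately have "((\<lambda>z::complex. 1::complex) \<longlongrightarrow> 0 * L) at_infinity"
      by (rule Lim_transform_eventually)
    hence "(1::complex) = 0 * L"
      by (rule tendsto_unique[OF trivial_limit_at_infinity tendsto_const])
    thus False by simp
  qed
  moreover have "f - ratfun_const c = Fract p b"
    using b0 by (subst f) (simp add: ratfun_const_def to_fract_def p_def)
  moreover have "real_poly p" unfolding p_def using r assms(1)
    by (intro real_poly_intros) (auto simp: real_poly_pCons_iff)
  ultimately show ?thesis using r b0 by (auto intro: real_properI)
qed

section \<open>Gaussian elimination in the real loop group\<close>

lemma ratfun_const_simps [simp]: "ratfun_const 0 = 0" "ratfun_const 1 = 1"
  "ratfun_const (a + b) = ratfun_const a + ratfun_const b"
  "ratfun_const (a - b) = ratfun_const a - ratfun_const b"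
  by (simp_all add: ratfun_const_def flip: one_pCons to_fract_add to_fract_diff)

lemma real_proper_const_mult [intro]:
  assumes "f \<in> real_proper" "c \<in> \<real>"
  shows "f * ratfun_const c \<in> real_proper"
proof -
  obtain p q where f: "f = Fract p q" "real_poly p" "real_poly q" "q \<noteq> 0" "p = 0 \<or> degree p < degree q"
    using assms(1) by (rule real_properE)
  have "f * ratfun_const c = Fract (p * [:c:]) q" using f by (simp add: ratfun_const_def to_fract_def)
  moreover have "real_poly (p * [:c:])"
    using f assms by (intro real_poly_intros) (auto simp: real_poly_pCons_iff)
  ultimately show ?thesis using f by (cases "c = 0") (auto intro!: real_properI)
qed

lemma real_proper_div_unit:
  assumes "f \<in> real_proper" "u - 1 \<in> real_proper"
  shows "f / u \<in> real_proper"
proof -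
  have "f / u = f * (inverse u - 1) + f" by (simp add: field_simps)
  thus ?thesis using assms one_plus_real_proper_inverse by auto
qed

section \<open>The congruence group modulo the ideal\<close>

definition real_cong :: "(ratfun ^ 'n ^ 'n::finite) set" where
  "real_cong = {g. \<forall>i j. g $ i $ j - mat 1 $ i $ j \<in> real_proper}"

lemma real_congI: "(\<And>i j. g $ i $ j - mat 1 $ i $ j \<in> real_proper) \<Longrightarrow> g \<in> real_cong"
  by (simp add: real_cong_def)

lemma real_congD: "g \<in> real_cong \<Longrightarrow> g $ i $ j - mat 1 $ i $ j \<in> real_proper"
  by (simp add: real_cong_def)

lemma ratmat_eval_nth [simp]: "ratmat_eval g z $ i $ j = ratfun_eval (g $ i $ j) z"
  by (simp add: ratmat_eval_def map_matrix_def)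

lemma map_matrix_nth [simp]: "map_matrix f A $ i $ j = f (A $ i $ j)"
  by (simp add: map_matrix_def)

lemma mat_1_eq_const: "(mat 1 :: ratfun ^ 'n ^ 'n) $ i $ j = ratfun_const ((mat 1 :: complex ^ 'n ^ 'n::finite) $ i $ j)"
  by (simp add: mat_def)

lemma mat_1_nth_Reals: "(mat 1 :: complex ^ 'n ^ 'n::finite) $ i $ j \<in> \<real>"
  by (simp add: mat_def)

text \<open>Both the normalization and the reality condition can be read entry by entry, with limit
  0 or 1; together they say that the entry minus its limit lies in
  \<open>real_proper\<close>.\<close>

lemma carrier_LGL_real: "carrier LGL_real = {g \<in> real_cong. det g \<noteq> 0}"
proof (intro equalityI subsetI)
  fix g :: "ratfun ^ 'n ^ 'n" assume "g \<in> carrier LGL_real"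
  hence g: "det g \<noteq> 0" "(ratmat_eval g \<longlongrightarrow> mat 1) at_infinity" "GL_real_condition g"
    by (auto simp: LGL_real_def LGL_complex_def)
  have "g $ i $ j - mat 1 $ i $ j \<in> real_proper" for i j
    unfolding mat_1_eq_const
  proof (rule in_real_properI[OF mat_1_nth_Reals])
    show "(ratfun_eval (g $ i $ j) \<longlongrightarrow> mat 1 $ i $ j) at_infinity"
      using tendsto_vec_nth[OF tendsto_vec_nth[OF g(2)], of i j] by simp
    show "finite {z. ratmat_pole g z}" by (rule finite_ratmat_poles)
    fix z assume "z \<notin> {z. ratmat_pole g z}" "cnj z \<notin> {z. ratmat_pole g z}"
    hence "map_matrix cnj (ratmat_eval g (cnj z)) = ratmat_eval g z"
      using g(3) by (simp add: GL_real_condition_def)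
    thus "cnj (ratfun_eval (g $ i $ j) (cnj z)) = ratfun_eval (g $ i $ j) z"
      by (metis map_matrix_nth ratmat_eval_nth)
  qed
  thus "g \<in> {g \<in> real_cong. det g \<noteq> 0}" using g by (auto intro: real_congI)
next
  fix g :: "ratfun ^ 'n ^ 'n" assume "g \<in> {g \<in> real_cong. det g \<noteq> 0}"
  hence d: "det g \<noteq> 0" and g: "g $ i $ j - ratfun_const (mat 1 $ i $ j) \<in> real_proper" for i j
    using real_congD[of g] by (auto simp: mat_1_eq_const)
  have "(ratmat_eval g \<longlongrightarrow> mat 1) at_infinity"
    using real_proper_imp_tendsto[OF g mat_1_nth_Reals] by (intro vec_tendstoI) simp
  moreover have "GL_real_condition g"
    using real_proper_imp_cnj_eval[OF g mat_1_nth_Reals] by (simp add: GL_real_condition_def vec_eq_iff)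
  ultimately show "g \<in> carrier LGL_real" using d by (simp add: LGL_real_def LGL_complex_def)
qed

lemma real_cong_mult:
  assumes "g \<in> real_cong" "h \<in> real_cong"
  shows "g ** h \<in> real_cong"
proof (rule real_congI)
  fix i j
  \<comment> \<open>With \<open>1\<close> the identity matrix, this expands
    \<open>(g - 1)(h - 1)\<close>, so that
    \<open>gh - 1 = (g - 1) + (h - 1) + (g - 1)(h - 1)\<close>, where every summand has entries in
    the ideal.\<close>
  have "(\<Sum>k\<in>UNIV. (g $ i $ k - mat 1 $ i $ k) * (h $ k $ j - mat 1 $ k $ j))
     = (g ** h) $ i $ j - (g ** mat 1) $ i $ j - (mat 1 ** h) $ i $ j + (mat 1 ** mat 1) $ i $ j"
    unfolding matrix_matrix_mult_def
    by (simp add: algebra_simps sum.distrib sum_subtractf)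
  hence "(g ** h) $ i $ j - mat 1 $ i $ j = (g $ i $ j - mat 1 $ i $ j) + (h $ i $ j - mat 1 $ i $ j) +
      (\<Sum>k\<in>UNIV. (g $ i $ k - mat 1 $ i $ k) * (h $ k $ j - mat 1 $ k $ j))"
    by simp
  also have "\<dots> \<in> real_proper"
    using real_congD[OF assms(1)] real_congD[OF assms(2)] by (intro real_proper_add real_proper_sum real_proper_mult)
  finally show "(g ** h) $ i $ j - mat 1 $ i $ j \<in> real_proper" .
qed

section \<open>Elementary matrices and their products\<close>

text \<open>One notation serves both kinds of factor: a transvection for
  \<open>i \<noteq> j\<close>, and the diagonal matrix with entry \<open>1 + f\<close> for
  \<open>i = j\<close>.\<close>

definition elem_mat :: "'n \<Rightarrow> 'n \<Rightarrow> 'a::comm_ring_1 \<Rightarrow> 'a ^ 'n ^ 'n::finite" where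
  "elem_mat i j f = (\<chi> a b. mat 1 $ a $ b + (if a = i \<and> b = j then f else 0))"

lemma elem_mat_nth: "elem_mat i j f $ a $ b = mat 1 $ a $ b + (if a = i \<and> b = j then f else 0)"
  by (simp add: elem_mat_def)

lemma elem_mat_mult_nth:
  "(elem_mat i j f ** A) $ a $ b = A $ a $ b + (if a = i then f * A $ j $ b else 0)"
proof -
  have "(elem_mat i j f ** A) $ a $ b =
      (mat 1 ** A) $ a $ b + (\<Sum>k\<in>UNIV. if k = j then (if a = i then f * A $ j $ b else 0) else 0)"
    unfolding matrix_matrix_mult_def vec_lambda_beta sum.distrib[symmetric]
    by (intro sum.cong) (auto simp: elem_mat_nth distrib_right)
  thus ?thesis by simp
qed

lemma transpose_elem_mat: "transpose (elem_mat i j f) = elem_mat j i f"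
  by (auto simp: vec_eq_iff transpose_def elem_mat_nth mat_def)

lemma elem_mat_0 [simp]: "elem_mat i j 0 = mat 1"
  by (simp add: vec_eq_iff elem_mat_nth)

lemma elem_mat_add: "i \<noteq> j \<Longrightarrow> elem_mat i j f ** elem_mat i j g = elem_mat i j (f + g)"
  by (auto simp: vec_eq_iff elem_mat_mult_nth elem_mat_nth mat_def)

lemma elem_mat_diag_mult: "elem_mat i i (u - 1) ** elem_mat i i (v - 1) = elem_mat i i (u * v - 1)"
  by (auto simp: vec_eq_iff elem_mat_mult_nth elem_mat_nth mat_def algebra_simps)

lemma mat_1_in_real_cong [simp]: "mat 1 \<in> real_cong"
  by (simp add: real_cong_def)

lemma elem_mat_in_real_cong: "f \<in> real_proper \<Longrightarrow> elem_mat i j f \<in> real_cong"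
  by (auto simp: real_cong_def elem_mat_nth)

text \<open>Off the diagonal the entry is negated; on the diagonal the unit \<open>1 + f\<close> is
  inverted.\<close>

lemma elem_mat_inverse:
  assumes "f \<in> real_proper"
  obtains g where "g \<in> real_proper" "elem_mat i j g ** elem_mat i j f = mat 1"
    "elem_mat i j f ** elem_mat i j g = mat 1"
proof (cases "i = j")
  case False
  thus ?thesis using assms that[of "- f"] by (auto simp: elem_mat_add)
next
  case True
  define u where "u = 1 + f"
  have u: "u - 1 \<in> real_proper" and f: "f = u - 1" using assms by (simp_all add: u_def)
  have "u \<noteq> 0" using one_plus_real_proper_nonzero[OF u] .
  thus ?thesis using that[of "inverse u - 1"] one_plus_real_proper_inverse[OF u] True
    by (simp add: f elem_mat_diag_mult)
qed

inductive_set elem_prod :: "(ratfun ^ 'n ^ 'n::finite) set" where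
  one: "mat 1 \<in> elem_prod"
| elem: "f \<in> real_proper \<Longrightarrow> elem_mat i j f \<in> elem_prod"
| mult: "A \<in> elem_prod \<Longrightarrow> B \<in> elem_prod \<Longrightarrow> A ** B \<in> elem_prod"

lemma elem_prod_in_real_cong: "A \<in> elem_prod \<Longrightarrow> A \<in> real_cong"
  by (induction rule: elem_prod.induct) (auto intro: elem_mat_in_real_cong real_cong_mult)

text \<open>Allows row elimination to be handled as column elimination of the transpose.\<close>

lemma elem_prod_transpose: "A \<in> elem_prod \<Longrightarrow> transpose A \<in> elem_prod"
  by (induction rule: elem_prod.induct)
    (auto simp: transpose_elem_mat matrix_transpose_mul transpose_mat intro: elem_prod.intros)

lemma elem_prod_inverse:
  assumes "A \<in> elem_prod"
  shows "\<exists>B\<in>elem_prod. B ** A = mat 1 \<and> A ** B = mat 1"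
  using assms
proof (induction rule: elem_prod.induct)
  case one
  thus ?case by (intro bexI[of _ "mat 1"]) (auto intro: elem_prod.one)
next
  case (elem f i j)
  thus ?case by (metis elem_mat_inverse elem_prod.elem)
next
  case (mult A B)
  then obtain A' B' where "A' \<in> elem_prod" "B' \<in> elem_prod" "A' ** A = mat 1" "A ** A' = mat 1"
    "B' ** B = mat 1" "B ** B' = mat 1" by metis
  thus ?case
    by (intro bexI[of _ "B' ** A'"])
      (auto intro: elem_prod.mult, (metis matrix_mul_assoc matrix_mul_lid)+)
qed

section \<open>Elimination of a column and a row at a pivot\<close>

definition col_mat :: "'n \<Rightarrow> ('n \<Rightarrow> 'a::comm_ring_1) \<Rightarrow> 'a ^ 'n ^ 'n::finite" where
  "col_mat k c = (\<chi> a b. mat 1 $ a $ b + (if b = k then c a else 0))"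

lemma col_mat_nth: "col_mat k c $ a $ b = mat 1 $ a $ b + (if b = k then c a else 0)"
  by (simp add: col_mat_def)

lemma col_mat_mult_nth: "(col_mat k c ** A) $ a $ b = A $ a $ b + c a * A $ k $ b"
proof -
  have "(col_mat k c ** A) $ a $ b =
      (mat 1 ** A) $ a $ b + (\<Sum>l\<in>UNIV. if l = k then c a * A $ k $ b else 0)"
    unfolding matrix_matrix_mult_def vec_lambda_beta sum.distrib[symmetric]
    by (intro sum.cong) (auto simp: col_mat_nth distrib_right)
  thus ?thesis by simp
qed

text \<open>Row \<open>k\<close> of a partial product is the unit row as long as only other rows
  have been filled, so each further elementary factor on the left fills exactly one entry of column
  \<open>k\<close>. The diagonal factor comes last.\<close>

lemma col_mat_in_elem_prod:
  assumes "\<And>a. c a \<in> real_proper"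
  shows "col_mat k c \<in> elem_prod"
proof -
  have *: "col_mat k (\<lambda>a. if a \<in> S then c a else 0) \<in> elem_prod" if "finite S" "k \<notin> S" for S
    using that
  proof (induction S)
    case empty
    have "col_mat k (\<lambda>a. if a \<in> {} then c a else 0) = mat 1"
      by (simp add: vec_eq_iff col_mat_nth)
    thus ?case by (simp add: elem_prod.one)
  next
    case (insert i S)
    have "col_mat k (\<lambda>a. if a \<in> insert i S then c a else 0) =
        elem_mat i k (c i) ** col_mat k (\<lambda>a. if a \<in> S then c a else 0)"
      using insert by (auto simp: vec_eq_iff elem_mat_mult_nth col_mat_nth mat_def)
    thus ?case using insert assms by (auto intro: elem_prod.intros)
  qed
  have "col_mat k c = elem_mat k k (c k) ** col_mat k (\<lambda>a. if a \<in> UNIV - {k} then c a else 0)"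
    by (auto simp: vec_eq_iff elem_mat_mult_nth col_mat_nth mat_def)
  thus ?thesis using *[of "UNIV - {k}"] assms by (auto intro: elem_prod.intros)
qed

text \<open>Gaussian elimination never needs a pivot search, because the diagonal entries stay in
  the unit group \<open>1 + real_proper\<close>.\<close>

lemma real_cong_in_elem_prod:
  assumes "g \<in> real_cong"
  shows "g \<in> elem_prod"
proof -
  have "g \<in> elem_prod" if "finite S" "g \<in> real_cong"
    "\<And>a b. a \<notin> S \<or> b \<notin> S \<Longrightarrow> g $ a $ b = mat 1 $ a $ b" for S and g :: "ratfun ^ 'n ^ 'n"
    using that
  proof (induction S arbitrary: g)
    case empty
    hence "g = mat 1" by (simp add: vec_eq_iff)
    thus ?case by (simp add: elem_prod.one)
  next
    case (insert k S)
    note M = real_congD[OF insert.prems(1)]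
    define u where "u = g $ k $ k"
    have u: "u - 1 \<in> real_proper" using M[of k k] by (simp add: u_def mat_def)
    have u0: "u \<noteq> 0" using one_plus_real_proper_nonzero[OF u] .
    \<comment> \<open>Left multiplication by \<open>col_mat k c\<close> will restore the pivot
      column, and right multiplication by the transpose of \<open>col_mat k d\<close> the pivot row,
      divided in \<open>d\<close> by the pivot \<open>u\<close>.\<close>
    define c where "c a = g $ a $ k - mat 1 $ a $ k" for a
    define d where "d b = (if b = k then 0 else g $ k $ b / u)" for b
    \<comment> \<open>The Schur complement of the pivot \<open>u\<close>, bordered by the row and
      column \<open>k\<close> of the identity.\<close>
    define h :: "ratfun ^ 'n ^ 'n" where
      "h = (\<chi> a b. if a = k \<or> b = k then mat 1 $ a $ b else g $ a $ b - g $ a $ k * g $ k $ b / u)"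
    have off: "g $ a $ b \<in> real_proper" if "a \<noteq> b" for a b
      using M[of a b] that by (simp add: mat_def)
    have c: "c a \<in> real_proper" for a using M by (simp add: c_def)
    have d: "d b \<in> real_proper" for b using u off by (auto simp: d_def intro: real_proper_div_unit)
    have "h \<in> real_cong"
    proof (rule real_congI)
      fix a b
      show "h $ a $ b - mat 1 $ a $ b \<in> real_proper"
      proof (cases "a = k \<or> b = k")
        case False
        hence "h $ a $ b - mat 1 $ a $ b = (g $ a $ b - mat 1 $ a $ b) - g $ a $ k * g $ k $ b / u"
          by (simp add: h_def)
        thus ?thesis using M off False u
          by (metis real_proper_diff real_proper_div_unit real_proper_mult)
      qed (auto simp: h_def)
    qed
    moreover have "h $ a $ b = mat 1 $ a $ b" if "a \<notin> S \<or> b \<notin> S" for a b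
    proof (cases "a = k \<or> b = k")
      case False
      \<comment> \<open>Outside the active block \<open>g\<close> agrees with the identity, so a
        factor of the correction term vanishes.\<close>
      hence "a \<notin> insert k S \<or> b \<notin> insert k S" using that by auto
      moreover from this have "g $ a $ k = 0 \<or> g $ k $ b = 0"
        using insert.prems(2)[of a k] insert.prems(2)[of k b] False by (auto simp: mat_def)
      ultimately show ?thesis using insert.prems(2)[of a b] False by (auto simp: h_def)
    qed (auto simp: h_def)
    ultimately have h: "h \<in> elem_prod" by (rule insert.IH)
    have "(col_mat k c ** h) $ a $ b = (if b = k then g $ a $ k else h $ a $ b)" for a b
      by (auto simp: col_mat_mult_nth h_def c_def mat_def)
    hence "(col_mat k d ** transpose (col_mat k c ** h)) $ b $ a = g $ a $ b" for a b
      using u0 by (auto simp: col_mat_mult_nth transpose_def d_def h_def u_def mat_def)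
    hence "transpose g = col_mat k d ** transpose (col_mat k c ** h)"
      by (simp add: vec_eq_iff transpose_def)
    hence "g = transpose (col_mat k d ** transpose (col_mat k c ** h))"
      by (metis transpose_transpose)
    thus ?case using h c d by (auto intro!: elem_prod_transpose elem_prod.mult col_mat_in_elem_prod)
  qed
  from this[of UNIV g] assms show ?thesis by simp
qed

text \<open>The factorization into elementary matrices supplies an inverse, so the determinant is a
  unit. The carrier is therefore all of \<open>real_cong\<close>.\<close>

lemma det_real_cong:
  assumes "g \<in> real_cong"
  shows "det g \<noteq> 0"
proof -
  obtain h where "h ** g = mat 1" using elem_prod_inverse real_cong_in_elem_prod[OF assms] by blast
  hence "det h * det g = 1" by (metis det_I det_mul)
  thus ?thesis by auto
qed

lemma carrier_LGL_real_eq: "carrier LGL_real = real_cong"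
  using det_real_cong by (auto simp: carrier_LGL_real)

lemma mult_LGL_real [simp]: "mult LGL_real = (**)"
  and one_LGL_real [simp]: "one LGL_real = mat 1"
  by (simp_all add: LGL_real_def LGL_complex_def)

lemma group_LGL_real: "group (LGL_real :: (ratfun ^ 'n ^ 'n::finite) monoid)"
proof (rule groupI)
  fix g :: "ratfun ^ 'n ^ 'n" assume "g \<in> carrier LGL_real"
  hence "\<exists>h\<in>elem_prod. h ** g = mat 1"
    using elem_prod_inverse[OF real_cong_in_elem_prod] by (auto simp: carrier_LGL_real_eq)
  thus "\<exists>h\<in>carrier LGL_real. h \<otimes>\<^bsub>LGL_real\<^esub> g = \<one>\<^bsub>LGL_real\<^esub>"
    using elem_prod_in_real_cong by (auto simp: carrier_LGL_real_eq)
qed (auto simp: carrier_LGL_real_eq real_cong_mult matrix_mul_assoc)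

section \<open>Projections and the generating loops\<close>

lemma scaled_nth [simp]: "scaled f A $ i $ j = f * ratfun_const (A $ i $ j)"
  by (simp add: scaled_def)

text \<open>A matrix is determined by its action on two subspaces that span the space; this gives
  the uniqueness behind the definite description in \<open>proj\<close>.\<close>

lemma proj_eqI:
  assumes "V + W = UNIV" "\<And>v. v \<in> V \<Longrightarrow> P *v v = v" "\<And>w. w \<in> W \<Longrightarrow> P *v w = 0"
  shows "proj V W = P"
  unfolding proj_def
proof (rule the_equality)
  fix Q assume Q: "(\<forall>v\<in>V. Q *v v = v) \<and> (\<forall>w\<in>W. Q *v w = 0)"
  have "Q *v x = P *v x" for x
  proof -
    obtain v w where "x = v + w" "v \<in> V" "w \<in> W"
      using assms(1) by (metis UNIV_I set_plus_elim)
    thus ?thesis using Q assms by (simp add: matrix_vector_right_distrib)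
  qed
  thus "Q = P" by (simp add: matrix_eq)
qed (use assms in auto)

text \<open>Existence: the \<open>V\<close>-component of a vector is unique because \<open>V\<close>
  and \<open>W\<close> meet only in 0, and uniqueness makes the chosen component linear.\<close>

lemma direct_sum2_projection:
  assumes "direct_sum2 V W"
  obtains P where "\<And>v. v \<in> V \<Longrightarrow> P *v v = v" "\<And>w. w \<in> W \<Longrightarrow> P *v w = 0"
proof -
  have sV: "vec.subspace V" and sW: "vec.subspace W" and VW: "V \<inter> W = {0}" and U: "V + W = UNIV"
    using assms by (auto simp: direct_sum2_def)
  define p where "p x = (SOME v. v \<in> V \<and> x - v \<in> W)" for x
  have p: "p x \<in> V \<and> x - p x \<in> W" for x
  proof -
    obtain v w where "x = v + w" "v \<in> V" "w \<in> W" using U by (metis UNIV_I set_plus_elim)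
    hence "v \<in> V \<and> x - v \<in> W" by simp
    thus ?thesis unfolding p_def by (rule someI)
  qed
  have uniq: "p x = v" if "v \<in> V" "x - v \<in> W" for x v
  proof -
    have "p x - v \<in> V" using p that vec.subspace_diff[OF sV] by blast
    moreover have "(x - v) - (x - p x) \<in> W" using p that vec.subspace_diff[OF sW] by blast
    ultimately have "p x - v \<in> V \<inter> W" by simp
    thus ?thesis using VW by simp
  qed
  have "Vector_Spaces.linear (*s) (*s) p"
  proof unfold_locales
    fix x y
    show "p (x + y) = p x + p y"
    proof (rule uniq)
      show "p x + p y \<in> V" using p vec.subspace_add[OF sV] by blast
      have "(x - p x) + (y - p y) \<in> W" using p vec.subspace_add[OF sW] by blast
      thus "x + y - (p x + p y) \<in> W" by (simp add: algebra_simps)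
    qed
  next
    fix c x
    show "p (c *s x) = c *s p x"
    proof (rule uniq)
      show "c *s p x \<in> V" using p vec.subspace_scale[OF sV] by blast
      have "c *s (x - p x) \<in> W" using p vec.subspace_scale[OF sW] by blast
      thus "c *s x - c *s p x \<in> W" by (simp add: vec.scale_right_diff_distrib)
    qed
  qed
  hence m: "matrix p *v x = p x" for x by (rule matrix_works)
  show ?thesis
  proof (rule that[of "matrix p"])
    show "matrix p *v v = v" if "v \<in> V" for v
      using that vec.subspace_0[OF sW] by (simp add: m uniq)
    show "matrix p *v w = 0" if "w \<in> W" for w
      using that vec.subspace_0[OF sV] by (simp add: m uniq)
  qed
qed

lemma
  assumes "direct_sum2 V W"
  shows proj_fixes: "v \<in> V \<Longrightarrow> proj V W *v v = v"
    and proj_kills: "w \<in> W \<Longrightarrow> proj V W *v w = 0"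
proof -
  obtain P where P: "\<And>v. v \<in> V \<Longrightarrow> P *v v = v" "\<And>w. w \<in> W \<Longrightarrow> P *v w = 0"
    using direct_sum2_projection[OF assms] by metis
  have "proj V W = P" using assms P by (intro proj_eqI) (auto simp: direct_sum2_def)
  thus "v \<in> V \<Longrightarrow> proj V W *v v = v" "w \<in> W \<Longrightarrow> proj V W *v w = 0" using P by auto
qed

lemma proj_complement:
  assumes "direct_sum2 V W"
  shows "proj W V = mat 1 - proj V W"
proof (rule proj_eqI)
  show "W + V = UNIV" using assms by (simp add: direct_sum2_def add.commute)
qed (use assms in \<open>auto simp: matrix_vector_mult_diff_rdistrib proj_fixes proj_kills\<close>)

section \<open>Conjugation of subspaces and real idempotents\<close>

definition cnj_vec :: "complex ^ 'n \<Rightarrow> complex ^ 'n::finite" where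
  "cnj_vec v = (\<chi> i. cnj (v $ i))"

lemma cnj_vec_simps [simp]: "cnj_vec (cnj_vec v) = v" "cnj_vec 0 = 0"
  "cnj_vec (u + v) = cnj_vec u + cnj_vec v" "cnj_vec (c *s v) = cnj c *s cnj_vec v"
  by (simp_all add: cnj_vec_def vec_eq_iff)

lemma conj_space_eq: "conj_space V = cnj_vec ` V"
  by (simp add: conj_space_def cnj_vec_def[abs_def])

lemma conj_space_conj_space [simp]: "conj_space (conj_space V) = V"
  by (simp add: conj_space_eq image_image)

lemma conj_space_plus: "conj_space (V + W) = conj_space V + conj_space W"
  unfolding conj_space_eq set_plus_def by force

lemma map_matrix_cnj_vec: "map_matrix cnj P *v v = cnj_vec (P *v cnj_vec v)"
  by (simp add: vec_eq_iff cnj_vec_def matrix_vector_mult_def)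

text \<open>The conjugated matrix acts as conjugation, then the projection, then conjugation again,
  so it fixes the conjugate of \<open>V\<close> and kills that of \<open>W\<close>.\<close>

lemma map_matrix_cnj_proj:
  assumes "direct_sum2 V W"
  shows "map_matrix cnj (proj V W) = proj (conj_space V) (conj_space W)"
proof (rule proj_eqI[symmetric])
  have "V + W = UNIV" using assms by (simp add: direct_sum2_def)
  hence "conj_space V + conj_space W = conj_space UNIV" by (metis conj_space_plus)
  moreover have "conj_space UNIV = (UNIV :: (complex ^ 'a) set)"
    unfolding conj_space_eq by (metis cnj_vec_simps(1) surjI)
  ultimately show "conj_space V + conj_space W = UNIV" by simp
qed (use assms in \<open>auto simp: conj_space_eq map_matrix_cnj_vec proj_fixes proj_kills\<close>)

lemma proj_real:
  assumes "direct_sum2 V W" "conj_space V = V" "conj_space W = W"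
  shows "proj V W $ i $ j \<in> \<real>"
  using map_matrix_cnj_proj[OF assms(1)] assms(2,3)
  by (metis Reals_cnj_iff map_matrix_nth)

text \<open>Fixed space and kernel of \<open>P\<close> split the space, and both are conjugation
  invariant because \<open>P\<close> commutes with conjugation. Generating loops can thus be
  specified by real idempotent matrices.\<close>

lemma real_idempotent_splitting:
  fixes P :: "complex ^ 'n ^ 'n::finite"
  assumes "P ** P = P" "map_matrix cnj P = P"
  obtains V W where "direct_sum2 V W" "conj_space V = V" "conj_space W = W" "proj V W = P"
proof -
  define V where "V = {v. P *v v = v}"
  define W where "W = {w. P *v w = 0}"
  have idem: "P *v (P *v v) = P *v v" for v by (simp add: matrix_vector_mul_assoc assms(1))
  have "v \<in> V + W" for v
  proof -
    have "v = P *v v + (v - P *v v)" by simp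
    moreover have "P *v v \<in> V" "v - P *v v \<in> W"
      by (auto simp: V_def W_def idem matrix_vector_mult_diff_distrib)
    ultimately show ?thesis by (metis set_plus_intro)
  qed
  hence VW: "V + W = UNIV" by blast
  have "vec.subspace V" "vec.subspace W"
    by (auto simp: vec.subspace_def V_def W_def matrix_vector_right_distrib vector_scalar_commute)
  moreover have "V \<inter> W = {0}" by (auto simp: V_def W_def)
  ultimately have "direct_sum2 V W" using VW by (simp add: direct_sum2_def)
  moreover have cP: "P *v cnj_vec v = cnj_vec (P *v v)" for v
    using map_matrix_cnj_vec[of P "cnj_vec v"] assms(2) by simp
  have closed: "conj_space U = U" if "\<And>v. v \<in> U \<Longrightarrow> cnj_vec v \<in> U" for U :: "(complex ^ 'n) set"
    using that unfolding conj_space_eq by (auto simp: image_iff) (metis cnj_vec_simps(1))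
  have "conj_space V = V" by (rule closed) (simp add: V_def cP)
  moreover have "conj_space W = W" by (rule closed) (simp add: W_def cP)
  moreover have "proj V W = P" by (rule proj_eqI[OF VW]) (auto simp: V_def W_def)
  ultimately show ?thesis using that by blast
qed

section \<open>The generating loops lie in the congruence group\<close>

lemma scaled_plus_complement:
  assumes "Q = mat 1 - P"
  shows "scaled f P + scaled 1 Q = mat 1 + scaled (f - 1) P"
  by (simp add: assms vec_eq_iff mat_1_eq_const algebra_simps)

lemma linear_frac_diff_1: "linear_frac \<alpha> \<beta> - 1 = Fract [:\<beta> - \<alpha>:] [:- \<beta>, 1:]"
  by (simp add: linear_frac_def One_fract_def)

lemma linear_frac_real:
  assumes "\<alpha> \<in> \<real>" "\<beta> \<in> \<real>"
  shows "linear_frac \<alpha> \<beta> - 1 \<in> real_proper"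
  unfolding linear_frac_diff_1
  using assms by (intro real_properI) (auto simp: real_poly_pCons_iff)

definition norm_poly :: "complex \<Rightarrow> complex poly" where
  "norm_poly \<alpha> = [:- \<alpha>, 1:] * [:- cnj \<alpha>, 1:]"

lemma norm_poly_simps [simp]: "real_poly (norm_poly \<alpha>)" "degree (norm_poly \<alpha>) = 2"
  "coeff (norm_poly \<alpha>) 2 = 1"
  by (auto simp: norm_poly_def real_poly_pCons_iff Reals_cnj_iff numeral_2_eq_2)

lemma norm_frac_real: "Fract (norm_poly \<alpha>) (norm_poly \<beta>) - 1 \<in> real_proper"
  by (rule Fract_monic_real) simp_all

lemma mat_1_plus_scaled_in_real_cong:
  assumes "f \<in> real_proper" "\<And>i j. P $ i $ j \<in> \<real>"
  shows "mat 1 + scaled f P \<in> real_cong"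
  using assms by (intro real_congI) (auto intro: real_proper_const_mult)

lemma p_loop_eq:
  "direct_sum2 V W \<Longrightarrow> p_loop \<alpha> \<beta> V W = mat 1 + scaled (linear_frac \<alpha> \<beta> - 1) (proj V W)"
  by (simp add: p_loop_def proj_complement scaled_plus_complement)

lemma q_loop_eq:
  "direct_sum2 V W \<Longrightarrow>
    q_loop \<alpha> \<beta> V W = mat 1 + scaled (Fract (norm_poly \<alpha>) (norm_poly \<beta>) - 1) (proj V W)"
  unfolding q_loop_def norm_poly_def[symmetric]
  by (simp add: proj_complement scaled_plus_complement)

lemma p_loops_in_real_cong: "p_loops \<subseteq> real_cong"
  by (auto simp: p_loops_def p_loop_eq intro!: mat_1_plus_scaled_in_real_cong linear_frac_real proj_real)

lemma q_loops_in_real_cong: "q_loops \<subseteq> real_cong"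
  by (auto simp: q_loops_def q_loop_eq intro!: mat_1_plus_scaled_in_real_cong norm_frac_real proj_real)

lemma conj_frac_sum_real:
  "(linear_frac \<alpha> \<beta> - 1) * ratfun_const c + (linear_frac (cnj \<alpha>) (cnj \<beta>) - 1) * ratfun_const (cnj c)
     \<in> real_proper"
proof -
  \<comment> \<open>Over the common denominator \<open>norm_poly \<beta>\<close> the first numerator
    is \<open>p\<close> and the second its conjugate, so their sum is real and of degree at most
    1.\<close>
  define p where "p = [:(\<beta> - \<alpha>) * c:] * [:- cnj \<beta>, 1:]"
  have "(linear_frac \<alpha> \<beta> - 1) * ratfun_const c + (linear_frac (cnj \<alpha>) (cnj \<beta>) - 1) * ratfun_const (cnj c)
      = Fract (p + map_poly cnj p) (norm_poly \<beta>)"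
    unfolding linear_frac_diff_1 ratfun_const_def to_fract_def mult_fract
    by (subst add_fract) (simp_all add: p_def norm_poly_def map_poly_cnj_mult map_poly_pCons algebra_simps)
  also have "\<dots> \<in> real_proper"
  proof (rule real_properI)
    have "map_poly cnj (map_poly cnj p) = p" by (simp add: poly_eq_poly_eq_iff[symmetric] fun_eq_iff)
    thus "real_poly (p + map_poly cnj p)" by (simp add: real_poly_def map_poly_cnj_add)
    have "degree p \<le> 1" unfolding p_def by simp
    hence "degree (p + map_poly cnj p) \<le> 1" by (intro degree_add_le) auto
    thus "p + map_poly cnj p = 0 \<or> degree (p + map_poly cnj p) < degree (norm_poly \<beta>)" by simp
    show "norm_poly \<beta> \<noteq> 0" by (simp add: norm_poly_def)
  qed simp
  finally show ?thesis .
qed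

lemma subspace_plus:
  fixes V W :: "(complex ^ 'n::finite) set"
  assumes "vec.subspace V" "vec.subspace W"
  shows "vec.subspace (V + W)"
proof -
  have "V + W = {x + y |x y. x \<in> V \<and> y \<in> W}" unfolding set_plus_def by blast
  thus ?thesis using vec.subspace_sums[OF assms] by simp
qed

text \<open>The projection onto the conjugate of \<open>V\<close> is the entrywise conjugate of the
  one onto \<open>V\<close>, so each entry of \<open>g - 1\<close> is a rational function plus its
  conjugate.\<close>

lemma r_loops_in_real_cong: "r_loops \<subseteq> real_cong"
proof
  fix g :: "ratfun ^ 'n ^ 'n" assume "g \<in> r_loops"
  then obtain \<alpha> \<beta> and V W :: "(complex ^ 'n) set" where g: "g = r_loop \<alpha> \<beta> V W"
    and ds: "direct_sum3 V W (conj_space V)" and W: "conj_space W = W"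
    by (auto simp: r_loops_def)
  define V' where "V' = conj_space V"
  have V': "conj_space V = V'" "conj_space V' = V" by (simp_all add: V'_def)
  note ds = ds[unfolded direct_sum3_def V']
  have d: "direct_sum2 V (W + V')" "direct_sum2 W (V + V')" "direct_sum2 V' (V + W)"
    using ds by (auto simp: direct_sum2_def subspace_plus add_ac)
  define A B C where "A = proj V (W + V')" and "B = proj W (V + V')" and "C = proj V' (V + W)"
  have "map_matrix cnj A = C"
    using map_matrix_cnj_proj[OF d(1)] by (simp add: A_def C_def conj_space_plus V' W add.commute)
  hence C: "C $ i $ j = cnj (A $ i $ j)" for i j by (metis map_matrix_nth)
  have zero: "0 \<in> V" "0 \<in> W" "0 \<in> V'" using ds by (auto dest: vec.subspace_0)
  have sub: "V \<subseteq> V + W" "V \<subseteq> V + V'" "W \<subseteq> V + W" "W \<subseteq> W + V'" "V' \<subseteq> V + V'" "V' \<subseteq> W + V'"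
    using set_zero_plus2[OF zero(2), of V] set_zero_plus2[OF zero(3), of V]
      set_zero_plus2[OF zero(1), of W] set_zero_plus2[OF zero(3), of W]
      set_zero_plus2[OF zero(1), of V'] set_zero_plus2[OF zero(2), of V']
    by (simp_all add: add.commute)
  \<comment> \<open>This eliminates \<open>B\<close>, leaving only the conjugate pair
    \<open>A\<close> and \<open>C\<close>.\<close>
  have "A + B + C = mat 1"
    unfolding matrix_eq
  proof
    fix x
    have "V + W + V' = UNIV" using ds by simp
    then obtain v w v' where x: "x = v + w + v'" "v \<in> V" "w \<in> W" "v' \<in> V'"
      by (metis UNIV_I set_plus_elim)
    have "A *v x = v"
      using x sub proj_fixes[OF d(1)] proj_kills[OF d(1)]
      by (simp add: A_def matrix_vector_right_distrib subset_iff)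
    moreover have "B *v x = w"
      using x sub proj_fixes[OF d(2)] proj_kills[OF d(2)]
      by (simp add: B_def matrix_vector_right_distrib subset_iff)
    moreover have "C *v x = v'"
      using x sub proj_fixes[OF d(3)] proj_kills[OF d(3)]
      by (simp add: C_def matrix_vector_right_distrib subset_iff)
    ultimately show "(A + B + C) *v x = mat 1 *v x"
      using x by (simp add: matrix_vector_mult_add_rdistrib)
  qed
  hence "(A + B + C) $ i $ j = mat 1 $ i $ j" for i j by simp
  hence B: "B $ i $ j = mat 1 $ i $ j - A $ i $ j - C $ i $ j" for i j
    by (simp add: algebra_simps)
  show "g \<in> real_cong"
  proof (rule real_congI)
    fix i j
    have "g $ i $ j - mat 1 $ i $ j = (linear_frac \<alpha> \<beta> - 1) * ratfun_const (A $ i $ j) +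
        (linear_frac (cnj \<alpha>) (cnj \<beta>) - 1) * ratfun_const (cnj (A $ i $ j))"
      unfolding g r_loop_def V' A_def[symmetric] B_def[symmetric] C_def[symmetric]
      by (simp add: B C mat_1_eq_const algebra_simps)
    thus "g $ i $ j - mat 1 $ i $ j \<in> real_proper" using conj_frac_sum_real by simp
  qed
qed

section \<open>Elementary matrices as products of generating loops\<close>

definition loop_gen :: "(ratfun ^ 'n ^ 'n::finite) set" where
  "loop_gen = generate LGL_real (p_loops \<union> q_loops \<union> r_loops)"

lemma loop_gen_mult: "A \<in> loop_gen \<Longrightarrow> B \<in> loop_gen \<Longrightarrow> A ** B \<in> loop_gen"
  unfolding loop_gen_def by (metis generate.eng mult_LGL_real)

lemma loop_gen_subset: "loop_gen \<subseteq> real_cong"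
proof -
  have "p_loops \<union> q_loops \<union> r_loops \<subseteq> carrier LGL_real"
    using p_loops_in_real_cong q_loops_in_real_cong r_loops_in_real_cong
    by (simp add: carrier_LGL_real_eq)
  thus ?thesis unfolding loop_gen_def
    using group.generate_incl[OF group_LGL_real] carrier_LGL_real_eq by metis
qed

text \<open>A left inverse in a group is the inverse, so closure under inverses reduces to one
  matrix identity.\<close>

lemma loop_gen_inverse:
  assumes "A \<in> loop_gen" "B \<in> real_cong" "B ** A = mat 1"
  shows "B \<in> loop_gen"
proof -
  have "inv\<^bsub>LGL_real\<^esub> A = B"
    using assms loop_gen_subset
    by (intro group.inv_equality[OF group_LGL_real]) (auto simp: carrier_LGL_real_eq)
  moreover have "inv\<^bsub>LGL_real\<^esub> A \<in> loop_gen"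
    using assms(1) p_loops_in_real_cong q_loops_in_real_cong r_loops_in_real_cong
    unfolding loop_gen_def
    by (intro group.generate_m_inv_closed[OF group_LGL_real]) (auto simp: carrier_LGL_real_eq)
  ultimately show ?thesis by simp
qed

lemma p_loop_idempotent_in_loop_gen:
  assumes "P ** P = P" "map_matrix cnj P = P" "\<alpha> \<in> \<real>" "\<beta> \<in> \<real>"
  shows "mat 1 + scaled (linear_frac \<alpha> \<beta> - 1) P \<in> loop_gen"
proof -
  obtain V W where VW: "direct_sum2 V W" "conj_space V = V" "conj_space W = W" "proj V W = P"
    using real_idempotent_splitting[OF assms(1,2)] by metis
  hence "p_loop \<alpha> \<beta> V W \<in> p_loops" using assms unfolding p_loops_def by blast
  thus ?thesis using VW unfolding loop_gen_def by (metis UnI1 generate.incl p_loop_eq)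
qed

lemma q_loop_idempotent_in_loop_gen:
  assumes "P ** P = P" "map_matrix cnj P = P" "\<alpha> \<notin> \<real> \<or> \<beta> \<notin> \<real>"
  shows "mat 1 + scaled (Fract (norm_poly \<alpha>) (norm_poly \<beta>) - 1) P \<in> loop_gen"
proof -
  obtain V W where VW: "direct_sum2 V W" "conj_space V = V" "conj_space W = W" "proj V W = P"
    using real_idempotent_splitting[OF assms(1,2)] by metis
  hence "q_loop \<alpha> \<beta> V W \<in> q_loops" using assms unfolding q_loops_def by blast
  thus ?thesis using VW unfolding loop_gen_def by (metis UnI1 UnI2 generate.incl q_loop_eq)
qed

section \<open>Diagonal and off-diagonal elementary matrices from real idempotents\<close>

definition row_idem :: "'n \<Rightarrow> 'n \<Rightarrow> complex \<Rightarrow> complex ^ 'n ^ 'n::finite" where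
  "row_idem i j c = (\<chi> a b. if a = i then (if b = i then 1 else if b = j then c else 0) else 0)"

lemma row_idem_idempotent: "row_idem i j c ** row_idem i j c = row_idem i j c"
proof -
  have "(\<Sum>k\<in>UNIV. row_idem i j c $ a $ k * row_idem i j c $ k $ b)
      = (\<Sum>k\<in>UNIV. if k = i then row_idem i j c $ a $ b else 0)" for a b
    by (intro sum.cong) (auto simp: row_idem_def)
  thus ?thesis by (simp add: vec_eq_iff matrix_matrix_mult_def)
qed

lemma row_idem_real: "c \<in> \<real> \<Longrightarrow> map_matrix cnj (row_idem i j c) = row_idem i j c"
  by (auto simp: vec_eq_iff row_idem_def Reals_cnj_iff)

lemma mat_1_plus_scaled_row_idem_0: "mat 1 + scaled f (row_idem i i 0) = elem_mat i i f"
  by (auto simp: vec_eq_iff row_idem_def elem_mat_nth)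

text \<open>Strong induction on the degree, splitting off a real root or a conjugate pair of roots.
  Every generator used has its pole at 0, so the denominators multiply to a power of
  \<open>\<lambda>\<close>.\<close>

lemma elem_mat_monic_in_loop_gen:
  assumes "real_poly p" "lead_coeff p = 1" "degree p = n"
  shows "elem_mat i i (Fract p ([:0, 1:] ^ n) - 1) \<in> loop_gen"
  using assms
proof (induction n arbitrary: p rule: less_induct)
  case (less n)
  define X where "X = ([:0, 1:] :: complex poly)"
  have step: "elem_mat i i (Fract p (X ^ n) - 1) \<in> loop_gen"
    if "p = s * p'" "real_poly s" "lead_coeff s = 1" "degree s = m" "m \<noteq> 0"
      "elem_mat i i (Fract s (X ^ m) - 1) \<in> loop_gen" for s p' m
  proof -
    have "s \<noteq> 0" using that by auto
    hence p': "real_poly p'" "p' \<noteq> 0" "lead_coeff p' = 1"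
      using that less.prems real_poly_mult_cancel[of s p'] by (auto simp: lead_coeff_mult)
    have n: "n = m + degree p'" using that less.prems \<open>s \<noteq> 0\<close> p' by (simp add: degree_mult_eq)
    have "elem_mat i i (Fract p' (X ^ degree p') - 1) \<in> loop_gen"
      unfolding X_def using p' n that by (intro less.IH) auto
    hence "elem_mat i i (Fract s (X ^ m) * Fract p' (X ^ degree p') - 1) \<in> loop_gen"
      unfolding elem_mat_diag_mult[symmetric] by (intro loop_gen_mult that)
    thus ?thesis using that by (simp add: n power_add)
  qed
  show ?case
  proof (cases "n = 0")
    case True
    hence "p = 1" using less.prems by (auto elim!: degree_eq_zeroE simp: one_pCons)
    thus ?thesis using True generate.one[of LGL_real]
      by (simp add: loop_gen_def fract_collapse)
  next
    case False
    then obtain \<alpha> where \<alpha>: "poly p \<alpha> = 0"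
      using fundamental_theorem_of_algebra[of p] less.prems by (auto simp: constant_degree)
    then obtain p1 where p1: "p = [:- \<alpha>, 1:] * p1" by (auto simp: poly_eq_0_iff_dvd elim: dvdE)
    show ?thesis
    proof (cases "\<alpha> \<in> \<real>")
      case True
      have "elem_mat i i (linear_frac \<alpha> 0 - 1) \<in> loop_gen"
        using p_loop_idempotent_in_loop_gen[OF row_idem_idempotent[of i i 0] row_idem_real True, of 0]
        by (simp add: mat_1_plus_scaled_row_idem_0)
      hence "elem_mat i i (Fract [:- \<alpha>, 1:] (X ^ 1) - 1) \<in> loop_gen"
        by (simp add: linear_frac_def X_def)
      from step[OF p1 _ _ _ _ this] show ?thesis
        using True by (simp add: real_poly_pCons_iff X_def)
    next
      case False
      have "cnj (poly p (cnj (cnj \<alpha>))) = poly p (cnj \<alpha>)" using less.prems(1) by (rule real_poly_cnj)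
      hence "poly p (cnj \<alpha>) = 0" using \<alpha> by simp
      \<comment> \<open>The linear factor already removed does not vanish at
        \<open>cnj \<alpha>\<close>, so this root of \<open>p\<close> must come from
        \<open>p1\<close>.\<close>
      moreover have "cnj \<alpha> \<noteq> \<alpha>" using False by (simp add: Reals_cnj_iff)
      ultimately have "poly p1 (cnj \<alpha>) = 0" by (simp add: p1)
      then obtain p2 where p2: "p1 = [:- cnj \<alpha>, 1:] * p2" by (auto simp: poly_eq_0_iff_dvd elim: dvdE)
      have "elem_mat i i (Fract (norm_poly \<alpha>) (norm_poly 0) - 1) \<in> loop_gen"
        using q_loop_idempotent_in_loop_gen[OF row_idem_idempotent[of i i 0] row_idem_real, of \<alpha> 0] False
        by (simp add: mat_1_plus_scaled_row_idem_0)
      moreover have "norm_poly 0 = X ^ 2" by (simp add: norm_poly_def X_def power2_eq_square)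
      ultimately have "elem_mat i i (Fract (norm_poly \<alpha>) (X ^ 2) - 1) \<in> loop_gen" by simp
      moreover have "p = norm_poly \<alpha> * p2" by (simp only: p1 p2 norm_poly_def mult.assoc)
      ultimately show ?thesis using step[of "norm_poly \<alpha>" p2 2] by (simp add: X_def)
    qed
  qed
qed

text \<open>For \<open>u = p/q\<close> with both parts monic of degree \<open>n\<close>, write
  \<open>u\<close> as \<open>p/\<lambda>^n\<close> times the inverse of
  \<open>q/\<lambda>^n\<close>.\<close>

lemma elem_mat_diag_in_loop_gen:
  assumes "u - 1 \<in> real_proper"
  shows "elem_mat i i (u - 1) \<in> loop_gen"
proof -
  obtain p q where u: "u = Fract p q" "real_poly p" "real_poly q"
    "lead_coeff p = 1" "lead_coeff q = 1" "degree p = degree q"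
    using one_plus_real_proper[OF assms] by metis
  define X where "X = ([:0, 1:] :: complex poly) ^ degree p"
  have X: "X \<noteq> 0" "real_poly X" "degree X = degree p"
    by (auto simp: X_def real_poly_pCons_iff degree_power_eq)
  have lc: "lead_coeff X = 1" unfolding X_def by (simp only: lead_coeff_power) simp
  have q0: "q \<noteq> 0" using u by auto
  have "elem_mat i i (Fract q X - 1) \<in> loop_gen"
    unfolding X_def using u by (intro elem_mat_monic_in_loop_gen) auto
  moreover have "elem_mat i i (Fract X q - 1) \<in> real_cong"
    using u X lc by (intro elem_mat_in_real_cong Fract_monic_real) auto
  moreover have "Fract X q * Fract q X = Fract 1 1" using q0 X by (simp add: eq_fract)
  hence "elem_mat i i (Fract X q - 1) ** elem_mat i i (Fract q X - 1) = mat 1"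
    by (simp add: elem_mat_diag_mult flip: One_fract_def)
  ultimately have "elem_mat i i (Fract X q - 1) \<in> loop_gen" by (rule loop_gen_inverse)
  moreover have "elem_mat i i (Fract p X - 1) \<in> loop_gen"
    unfolding X_def using u by (intro elem_mat_monic_in_loop_gen) auto
  ultimately have "elem_mat i i (Fract p X * Fract X q - 1) \<in> loop_gen"
    unfolding elem_mat_diag_mult[symmetric] by (intro loop_gen_mult)
  also have "Fract p X * Fract X q = u" using X u q0 by (simp add: eq_fract)
  finally show ?thesis .
qed

text \<open>With \<open>u = \<lambda>/(\<lambda> - 1)\<close>, the loop of the idempotent
  \<open>row_idem i j c\<close> has \<open>u\<close> and \<open>(u - 1) c\<close> in row
  \<open>i\<close>. Dividing that row by \<open>u\<close> leaves
  \<open>(1 - 1/u) c = c/\<lambda>\<close> off the diagonal.\<close>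

lemma elem_mat_simple_pole_in_loop_gen:
  assumes "i \<noteq> j" "c \<in> \<real>"
  shows "elem_mat i j (Fract [:c:] [:0, 1:]) \<in> loop_gen"
proof -
  define u where "u = linear_frac 0 1"
  have u: "u - 1 \<in> real_proper" unfolding u_def by (rule linear_frac_real) auto
  have iu: "inverse u - 1 \<in> real_proper" using one_plus_real_proper_inverse[OF u] .
  have u0: "u \<noteq> 0" using one_plus_real_proper_nonzero[OF u] .
  have x: "inverse u * ((u - 1) * ratfun_const c) = Fract [:c:] [:0, 1:]"
    unfolding u_def linear_frac_diff_1 unfolding linear_frac_def ratfun_const_def to_fract_def
    by (simp add: eq_fract)
  have "elem_mat i i (inverse u - 1) ** (mat 1 + scaled (u - 1) (row_idem i j c)) \<in> loop_gen"
    unfolding u_def using assms iu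
    by (intro loop_gen_mult elem_mat_diag_in_loop_gen p_loop_idempotent_in_loop_gen
        row_idem_idempotent row_idem_real) (auto simp: u_def)
  also have "elem_mat i i (inverse u - 1) ** (mat 1 + scaled (u - 1) (row_idem i j c)) =
      elem_mat i j (inverse u * ((u - 1) * ratfun_const c))"
    using assms(1) u0
    by (auto simp: vec_eq_iff elem_mat_mult_nth elem_mat_nth row_idem_def mat_def algebra_simps)
  finally show ?thesis by (simp add: x)
qed

lemma real_proper_leading_term:
  assumes "f \<in> real_proper"
  obtains c \<mu> where "c \<in> \<real>" "\<mu> \<in> real_proper"
    "f = Fract 1 [:0, 1:] * (ratfun_const c + \<mu>)"
proof -
  obtain p q where f: "f = Fract p q" "real_poly p" "real_poly q" "q \<noteq> 0" "p = 0 \<or> degree p < degree q"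
    using assms by (rule real_properE)
  define n where "n = degree q"
  \<comment> \<open>The limit of \<open>\<lambda> f\<close> at infinity: the coefficient is taken at
    \<open>degree q\<close>, so \<open>c\<close> is 0 when \<open>\<lambda> p\<close> has smaller
    degree.\<close>
  define c where "c = coeff (pCons 0 p) n / lead_coeff q"
  define r where "r = pCons 0 p - [:c:] * q"
  have cnj_coeff: "cnj (coeff s k) = coeff s k" if "real_poly s" for s k
    using that by (metis coeff_map_poly complex_cnj_zero real_poly_def)
  have rp: "real_poly (pCons 0 p)" using f by (simp add: real_poly_pCons_iff)
  have c: "c \<in> \<real>" using f rp by (simp add: c_def Reals_cnj_iff cnj_coeff)
  have "degree (pCons 0 p) \<le> n" using f by (auto simp: n_def)
  hence "degree r \<le> n" unfolding r_def n_def by (intro degree_diff_le) auto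
  moreover have "coeff r n = 0" using f by (simp add: r_def c_def n_def)
  ultimately have "r = 0 \<or> degree r < n" by (metis le_neq_implies_less leading_coeff_0_iff)
  moreover have "real_poly r" unfolding r_def using f rp c
    by (intro real_poly_intros) (auto simp: real_poly_pCons_iff)
  ultimately have "Fract r q \<in> real_proper" using f by (auto intro!: real_properI simp: n_def)
  moreover have "f = Fract 1 [:0, 1:] * (ratfun_const c + Fract r q)"
    using f(4) by (simp add: f(1) ratfun_const_def to_fract_def eq_fract r_def)
  ultimately show ?thesis using that c by blast
qed

text \<open>Conjugation by diagonal matrices multiplies the entry of an elementary matrix by an arbitrary
  unit \<open>1 + \<mu>\<close>; together with additivity this reaches every entry from real multiples of \<open>1/\<lambda>\<close>.\<close>

lemma elem_mat_off_diag_in_loop_gen: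
  assumes "i \<noteq> j" "f \<in> real_proper"
  shows "elem_mat i j f \<in> loop_gen"
proof -
  obtain c \<mu> where c: "c \<in> \<real>" "\<mu> \<in> real_proper" "f = Fract 1 [:0, 1:] * (ratfun_const c + \<mu>)"
    using real_proper_leading_term[OF assms(2)] by metis
  define u where "u = 1 + \<mu>"
  have u: "u - 1 \<in> real_proper" using c by (simp add: u_def)
  have u0: "u \<noteq> 0" using one_plus_real_proper_nonzero[OF u] .
  define t where "t = Fract 1 ([:0, 1:] :: complex poly)"
  have t: "elem_mat i j (t * ratfun_const d) \<in> loop_gen" if "d \<in> \<real>" for d
    using elem_mat_simple_pole_in_loop_gen[OF assms(1) that]
    by (simp add: t_def ratfun_const_def to_fract_def)
  have "elem_mat i i (u - 1) ** (elem_mat i j t ** elem_mat i i (inverse u - 1)) \<in> loop_gen"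
    using u t[of 1] one_plus_real_proper_inverse[OF u]
    by (intro loop_gen_mult elem_mat_diag_in_loop_gen) auto
  also have "elem_mat i i (u - 1) ** (elem_mat i j t ** elem_mat i i (inverse u - 1)) = elem_mat i j (u * t)"
    using assms(1) u0 by (auto simp: vec_eq_iff elem_mat_mult_nth elem_mat_nth mat_def algebra_simps)
  \<comment> \<open>The conjugation contributes \<open>1 + \<mu>\<close> where
    \<open>c + \<mu>\<close> is wanted; the second factor supplies the difference
    \<open>c - 1\<close>.\<close>
  finally have "elem_mat i j (u * t) ** elem_mat i j (t * ratfun_const (c - 1)) \<in> loop_gen"
    using c by (intro loop_gen_mult t) auto
  also have "elem_mat i j (u * t) ** elem_mat i j (t * ratfun_const (c - 1)) = elem_mat i j f"
    using assms(1) by (simp add: elem_mat_add c(3) u_def t_def algebra_simps)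
  finally show ?thesis .
qed

lemma elem_prod_in_loop_gen: "A \<in> elem_prod \<Longrightarrow> A \<in> loop_gen"
proof (induction rule: elem_prod.induct)
  case one
  thus ?case using generate.one[of LGL_real] by (simp add: loop_gen_def)
next
  case (elem f i j)
  thus ?case using elem_mat_diag_in_loop_gen[of "1 + f" i] elem_mat_off_diag_in_loop_gen[of i j f]
    by (cases "i = j") auto
qed (rule loop_gen_mult)

theorem theorem2p5:
  shows "generate (LGL_real :: (ratfun ^ 'n ^ 'n::finite) monoid) (p_loops \<union> q_loops \<union> r_loops)
           = carrier LGL_real"
  using loop_gen_subset elem_prod_in_loop_gen real_cong_in_elem_prod
  unfolding loop_gen_def carrier_LGL_real_eq by blast

end
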